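(* Let $\mathbf{w}$ be a normalized non-increasing bi-regular weight and $1\le p<\infty$. Then $\mathbf{w}\in\mathcal{W}$ and the canonical basis is not a symmetric basis for $g(\mathbf{w},p)$.
   Context: $\mathbb{F}$ is the real or complex field. A weight is a sequence $\mathbf{w}=(w_n)_{n=1}^\infty$ of positive scalars; it is normalized if $w_1=1$. A weight is regular if $\sup_m\frac{1}{mw_m}\sum_{n=1}^mw_n<\infty$. The conjugate weight of $\mathbf{w}$ is $\mathbf{w}^*=(w_n^* )_{n=1}^\infty$ with $w_n^*=\frac{1}{nw_n}$. A weight $\mathbf{w}$ is bi-regular if both $\mathbf{w}$ and $\mathbf{w}^*$ are regular. $\mathcal{W}$ is the set of sequences $\mathbf{w}=(w_n)_{n=1}^\infty$ in $c_0\setminus\ell_1$ of positive reals with $1=w_1\ge w_2\ge\cdots\ge w_n\ge w_{n+1}\ge\cdots>0$. $\mathcal{O}$ is the set of (strictly) increasing functions from $\mathbb{N}$ to $\mathbb{N}$. For $f=(a_n)_{n=1}^\infty\in\mathbb{F}^{\mathbb{N}}$ put $\|f\|_{g}=\sup_{\phi\in\mathcal{O}}\left(\sum_{n=1}^\infty|a_{\phi(n)}|^pw_n\right)^{1/p}$; the Garling sequence space is the Banach space $g(\mathbf{w},p)=\{f\in\mathbb{F}^{\mathbb{N}}:\|f\|_g<\infty\}$, whose canonical basis consists of the unit vectors $\mathbf{e}_n=(\delta_{k,n})_{k=1}^\infty$. Two basic sequences $(\mathbf{x}_n)$, $(\mathbf{y}_n)$ are equivalent if there is $C>0$ with $C^{-1}\|\sum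 a_n\mathbf{y}_n\|\le\|\sum a_n\mathbf{x}_n\|\le C\|\sum a_n\mathbf{y}_n\|$ for all finitely supported scalar sequences $(a_n)$. A basis is symmetric if it is equivalent to each of its permutations. *)

theory Defs
  imports "HOL-Analysis.Analysis"
begin

text \<open>
  All sequences are indexed from 0, so the entry written with index \<open>n + 1\<close> on paper
  is the value at \<open>n\<close> here. This shifts the explicit factors \<open>n\<close> and \<open>m\<close> in the conjugate
  weight and in the regularity condition to \<open>Suc n\<close> and \<open>Suc m\<close>.
\<close>

definition weight :: "(nat \<Rightarrow> real) \<Rightarrow> bool" where
  "weight w \<longleftrightarrow> (\<forall>n. 0 < w n)"

definition normalized :: "(nat \<Rightarrow> real) \<Rightarrow> bool" where
  "normalized w \<longleftrightarrow> w 0 = 1"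

definition regular_weight :: "(nat \<Rightarrow> real) \<Rightarrow> bool" where
  "regular_weight w \<longleftrightarrow> weight w \<and>
     bdd_above (range (\<lambda>m. 1 / (real (Suc m) * w m) * (\<Sum>n\<le>m. w n)))"

definition conj_weight :: "(nat \<Rightarrow> real) \<Rightarrow> nat \<Rightarrow> real" where
  "conj_weight w n = 1 / (real (Suc n) * w n)"

definition bi_regular :: "(nat \<Rightarrow> real) \<Rightarrow> bool" where
  "bi_regular w \<longleftrightarrow> regular_weight w \<and> regular_weight (conj_weight w)"

definition weight_class :: "(nat \<Rightarrow> real) set" where
  "weight_class = {w. w \<longlonglongrightarrow> 0 \<and> \<not> summable w \<and> w 0 = 1 \<and> decseq w \<and> (\<forall>n. 0 < w n)}"

text \<open>The power with exponent \<open>1 / p\<close> on \<open>[0, \<infinity>]\<close>, for \<open>p > 0\<close>.\<close>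

definition ennreal_root :: "real \<Rightarrow> ennreal \<Rightarrow> ennreal" where
  "ennreal_root p x = (if x = \<infinity> then \<infinity> else ennreal (enn2real x powr (1 / p)))"

definition garling_norm :: "(nat \<Rightarrow> real) \<Rightarrow> real \<Rightarrow> (nat \<Rightarrow> 'a::real_normed_field) \<Rightarrow> ennreal" where
  "garling_norm w p f =
     (SUP \<phi>\<in>{\<phi> :: nat \<Rightarrow> nat. strict_mono \<phi>}.
        ennreal_root p (\<Sum>n. ennreal (norm (f (\<phi> n)) powr p * w n)))"

definition garling_space :: "(nat \<Rightarrow> real) \<Rightarrow> real \<Rightarrow> (nat \<Rightarrow> 'a::real_normed_field) set" where
  "garling_space w p = {f. garling_norm w p f < \<infinity>}"

definition unit_vec :: "nat \<Rightarrow> nat \<Rightarrow> 'a::real_normed_field" where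
  "unit_vec n = (\<lambda>k. if k = n then 1 else 0)"

text \<open>
  In the following notions, \<open>X\<close> is a space of scalar sequences (with the pointwise vector space
  structure), and \<open>N\<close> is an extended norm on all scalar sequences that is finite on \<open>X\<close>.
  A sequence \<open>x\<close> of vectors has \<open>x n k\<close> as the \<open>k\<close>-th entry of its \<open>n\<close>-th vector.
\<close>

definition lin_comb ::
  "nat set \<Rightarrow> (nat \<Rightarrow> 'a) \<Rightarrow> (nat \<Rightarrow> nat \<Rightarrow> 'a) \<Rightarrow> nat \<Rightarrow> 'a::real_normed_field" where
  "lin_comb A a x = (\<lambda>k. \<Sum>n\<in>A. a n * x n k)"

definition schauder_basis ::
  "(nat \<Rightarrow> 'a::real_normed_field) set \<Rightarrow> ((nat \<Rightarrow> 'a) \<Rightarrow> ennreal) \<Rightarrow> (nat \<Rightarrow> nat \<Rightarrow> 'a) \<Rightarrow> bool" where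
  "schauder_basis X N x \<longleftrightarrow>
     range x \<subseteq> X \<and>
     (\<forall>f\<in>X. \<exists>!a. (\<lambda>m. N (\<lambda>k. f k - lin_comb {..<m} a x k)) \<longlonglongrightarrow> 0)"

definition equivalent_seqs ::
  "((nat \<Rightarrow> 'a::real_normed_field) \<Rightarrow> ennreal) \<Rightarrow> (nat \<Rightarrow> nat \<Rightarrow> 'a) \<Rightarrow> (nat \<Rightarrow> nat \<Rightarrow> 'a) \<Rightarrow> bool" where
  "equivalent_seqs N x y \<longleftrightarrow>
     (\<exists>C>0. \<forall>a. finite {n. a n \<noteq> 0} \<longrightarrow>
        ennreal (1 / C) * N (lin_comb {n. a n \<noteq> 0} a y) \<le> N (lin_comb {n. a n \<noteq> 0} a x) \<and>
        N (lin_comb {n. a n \<noteq> 0} a x) \<le> ennreal C * N (lin_comb {n. a n \<noteq> 0} a y))"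

definition symmetric_basis ::
  "(nat \<Rightarrow> 'a::real_normed_field) set \<Rightarrow> ((nat \<Rightarrow> 'a) \<Rightarrow> ennreal) \<Rightarrow> (nat \<Rightarrow> nat \<Rightarrow> 'a) \<Rightarrow> bool" where
  "symmetric_basis X N x \<longleftrightarrow>
     schauder_basis X N x \<and> (\<forall>\<pi>. bij \<pi> \<longrightarrow> equivalent_seqs N x (x \<circ> \<pi>))"

end

theory Submission
  imports Defs "HOL-Library.Nat_Bijection"
begin

text \<open>
  Let \<open>S\<^sub>n\<close> denote the partial sums of the weight. Regularity says that \<open>w\<^sub>n\<close> is at least a multiple
  of \<open>S\<^sub>n / n\<close>, hence of \<open>1 / n\<close>, so that \<open>w\<close> is not summable. Regularity of the conjugate weight says
  that \<open>\<Sum> 1 / (i w\<^sub>i)\<close>, over \<open>i \<le> n\<close>, is at most a multiple of \<open>1 / w\<^sub>n\<close>; comparison with the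
  harmonic series shows that \<open>w\<close> tends to zero.

  The unit vectors form a Schauder basis once the tails of every vector of finite norm tend to zero
  in norm. This is a gliding hump argument (\<open>eventually_tail_norm_le\<close>); it needs only that \<open>w\<close> is
  decreasing and not summable.

  The basis is not symmetric because the Garling norm depends on the order of the entries. Take the
  finite vector whose entries have \<open>p\<close>-th powers \<open>1 / S\<^sub>i\<close>. In decreasing order the \<open>p\<close>-th power of its
  norm is at least \<open>\<Sum> w\<^sub>n / S\<^sub>n\<close>, which is unbounded by regularity. In increasing order a selection
  can do no better than take the last \<open>j\<close> entries for some \<open>j\<close>, which gives the sum of \<open>w\<^sub>n / S\<^sub>i\<close> over
  \<open>n + i = j - 1\<close>. These sums are bounded (\<open>reversed_sum_bounded\<close>). A single permutation that
  reverses blocks of all lengths therefore turns the basis into an inequivalent one.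
\<close>

section \<open>The Garling norm through finite sums\<close>

text \<open>Decreasing positive weights starting with \<open>1\<close>. The arguments below work for every exponent
  \<open>p > 0\<close>.\<close>

locale garling_weight =
  fixes w :: "nat \<Rightarrow> real" and p :: real
  assumes w_pos: "0 < w n" and w_0: "w 0 = 1" and w_dec: "decseq w" and p_pos: "0 < p"
begin

lemma w_nonneg: "0 \<le> w n"
  using w_pos[of n] by simp

lemma w_antimono: "m \<le> n \<Longrightarrow> w n \<le> w m"
  using w_dec by (simp add: decseq_def)

lemma w_le_1: "w n \<le> 1"
  using w_antimono[of 0 n] w_0 by simp

lemma ennreal_root_le_iff:
  assumes "0 \<le> B"
  shows "ennreal_root p x \<le> ennreal B \<longleftrightarrow> x \<le> ennreal (B powr p)"
proof (cases x)
  case (real r)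
  have "r powr (1 / p) \<le> B \<longleftrightarrow> r \<le> B powr p"
  proof
    assume "r powr (1 / p) \<le> B"
    then have "(r powr (1 / p)) powr p \<le> B powr p"
      using p_pos by (intro powr_mono2) auto
    then show "r \<le> B powr p"
      using p_pos real by (simp add: powr_powr)
  next
    assume "r \<le> B powr p"
    then have "r powr (1 / p) \<le> (B powr p) powr (1 / p)"
      using p_pos real by (intro powr_mono2) auto
    then show "r powr (1 / p) \<le> B"
      using p_pos assms by (simp add: powr_powr)
  qed
  then show ?thesis
    using real assms by (simp add: ennreal_root_def)
next
  case top
  then show ?thesis by (simp add: ennreal_root_def top_unique)
qed

text \<open>Bounds on the Garling norm are bounds on real sums with finitely many terms, which keeps
  extended reals and infinite sums out of the later arguments.\<close>

lemma garling_norm_le_iff: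
  fixes f :: "nat \<Rightarrow> 'a::real_normed_field"
  assumes "0 \<le> B"
  shows "garling_norm w p f \<le> ennreal B \<longleftrightarrow>
    (\<forall>\<phi> M. strict_mono \<phi> \<longrightarrow> (\<Sum>n<M. norm (f (\<phi> n)) powr p * w n) \<le> B powr p)"
proof -
  have "(\<Sum>n. ennreal (norm (f (\<phi> n)) powr p * w n)) \<le> ennreal (B powr p) \<longleftrightarrow>
      (\<forall>M. (\<Sum>n<M. norm (f (\<phi> n)) powr p * w n) \<le> B powr p)" for \<phi>
    using assms w_nonneg
    by (simp add: suminf_eq_SUP SUP_le_iff sum_nonneg)
  then show ?thesis
    unfolding garling_norm_def using assms
    by (auto simp: SUP_le_iff ennreal_root_le_iff)
qed

lemma garling_norm_leD:
  fixes f :: "nat \<Rightarrow> 'a::real_normed_field"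
  assumes "garling_norm w p f \<le> ennreal B" and "0 \<le> B" and "strict_mono \<phi>"
  shows "(\<Sum>n<M. norm (f (\<phi> n)) powr p * w n) \<le> B powr p"
  using assms garling_norm_le_iff[of B f] by blast

lemma garling_spaceE:
  fixes f :: "nat \<Rightarrow> 'a::real_normed_field"
  assumes "f \<in> garling_space w p"
  obtains B where "0 \<le> B"
    and "\<And>\<phi> M. strict_mono \<phi> \<Longrightarrow> (\<Sum>n<M. norm (f (\<phi> n)) powr p * w n) \<le> B"
proof -
  from assms have "garling_norm w p f < top"
    by (simp add: garling_space_def)
  then obtain B where B: "0 \<le> B" "garling_norm w p f = ennreal B"
    by (cases "garling_norm w p f") auto
  then have "garling_norm w p f \<le> ennreal B" by simp
  then have "\<And>\<phi> M. strict_mono \<phi> \<Longrightarrow> (\<Sum>n<M. norm (f (\<phi> n)) powr p * w n) \<le> B powr p"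
    using garling_norm_leD B(1) by blast
  then show thesis using that[of "B powr p"] by simp
qed

lemma norm_coordinate_le:
  fixes f :: "nat \<Rightarrow> 'a::real_normed_field"
  shows "ennreal (norm (f k)) \<le> garling_norm w p f"
proof (cases "garling_norm w p f")
  case (real B)
  then have "garling_norm w p f \<le> ennreal B" by simp
  moreover have "strict_mono (\<lambda>n. k + n)" by (simp add: strict_mono_def)
  ultimately have "(\<Sum>n<Suc 0. norm (f (k + n)) powr p * w n) \<le> B powr p"
    using real(1) by (intro garling_norm_leD)
  then have le: "norm (f k) powr p \<le> B powr p" by (simp add: w_0)
  have "norm (f k) \<le> B"
  proof (rule ccontr)
    assume "\<not> norm (f k) \<le> B"
    then have "B powr p < norm (f k) powr p"
      using p_pos real by (intro powr_less_mono2) auto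
    with le show False by simp
  qed
  then show ?thesis using real by simp
qed simp

lemma unit_vec_in_space: "(unit_vec k :: nat \<Rightarrow> 'a::real_normed_field) \<in> garling_space w p"
proof -
  have "(\<Sum>n<M. norm (unit_vec k (\<phi> n) :: 'a) powr p * w n) \<le> 1 powr p"
    if "strict_mono \<phi>" for \<phi> M
  proof -
    have "(\<Sum>n<M. norm (unit_vec k (\<phi> n) :: 'a) powr p * w n)
        = (\<Sum>n\<in>{n. n < M \<and> \<phi> n = k}. w n)"
      by (rule sum.mono_neutral_cong_right) (auto simp: unit_vec_def)
    also have "\<dots> \<le> (\<Sum>n\<in>{n. n < M \<and> \<phi> n = k}. 1)"
      by (intro sum_mono w_le_1)
    also have "\<dots> \<le> 1"
    proof -
      have "card {n. n < M \<and> \<phi> n = k} \<le> 1"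
        using strict_mono_eq[OF that] by (auto simp: card_le_Suc0_iff_eq)
      then show ?thesis by simp
    qed
    finally show ?thesis by simp
  qed
  then have "garling_norm w p (unit_vec k :: nat \<Rightarrow> 'a) \<le> ennreal 1"
    using garling_norm_le_iff[of 1 "unit_vec k :: nat \<Rightarrow> 'a"] by auto
  then show ?thesis
    by (auto simp: garling_space_def intro: le_less_trans)
qed

section \<open>The unit vectors form a Schauder basis\<close>

lemma tendsto_0_if_in_space:
  fixes f :: "nat \<Rightarrow> 'a::real_normed_field"
  assumes "f \<in> garling_space w p" and "\<not> summable w"
  shows "f \<longlonglongrightarrow> 0"
proof (rule ccontr)
  assume "\<not> f \<longlonglongrightarrow> 0"
  then obtain e where e: "e > 0" "\<And>n0. \<exists>n\<ge>n0. e \<le> norm (f n)"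
    unfolding LIMSEQ_iff by (auto simp: not_less)
  let ?A = "{n. e \<le> norm (f n)}"
  have inf: "infinite ?A"
    using e(2) by (auto simp: infinite_nat_iff_unbounded_le)
  obtain B where B: "\<And>\<phi> M. strict_mono \<phi> \<Longrightarrow> (\<Sum>n<M. norm (f (\<phi> n)) powr p * w n) \<le> B"
    using garling_spaceE[OF assms(1)] by metis
  have "(\<Sum>n<M. w n) \<le> B / e powr p" for M
  proof -
    have "e powr p * (\<Sum>n<M. w n) \<le> (\<Sum>n<M. norm (f (enumerate ?A n)) powr p * w n)"
      unfolding sum_distrib_left
    proof (intro sum_mono mult_right_mono powr_mono2 w_nonneg)
      show "e \<le> norm (f (enumerate ?A n))" for n
        using enumerate_in_set[OF inf, of n] by blast
    qed (use e p_pos in auto)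
    also have "\<dots> \<le> B"
      by (rule B) (rule strict_mono_enumerate[OF inf])
    finally show ?thesis using e(1) by (simp add: field_simps)
  qed
  then have "summable w"
    by (intro summableI_nonneg_bounded[where x = "B / e powr p"]) (auto simp: w_nonneg)
  with assms(2) show False by simp
qed

text \<open>The vector obtained from \<open>f\<close> by deleting the first \<open>m\<close> entries (replacing them by zero).\<close>

definition tail :: "nat \<Rightarrow> (nat \<Rightarrow> 'a::real_normed_field) \<Rightarrow> nat \<Rightarrow> 'a" where
  "tail m f k = (if k < m then 0 else f k)"

lemma sum_lessThan_add:
  fixes g :: "nat \<Rightarrow> real"
  shows "(\<Sum>n<k + M. g n) = (\<Sum>n<k. g n) + (\<Sum>n<M. g (k + n))"
  by (induction M) auto

text \<open>A lower bound for the norm of a tail is witnessed by a selection that lives entirely in the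
  tail: dropping the selected indices below \<open>m\<close> moves the others to larger weights.\<close>

lemma tail_norm_witness:
  fixes f :: "nat \<Rightarrow> 'a::real_normed_field"
  assumes "0 \<le> e" and "\<not> garling_norm w p (tail m f) \<le> ennreal e"
  obtains \<psi> M where "strict_mono \<psi>" and "\<And>n. m \<le> \<psi> n"
    and "e powr p < (\<Sum>n<M. norm (f (\<psi> n)) powr p * w n)"
proof -
  obtain \<phi> M where \<phi>: "strict_mono \<phi>"
    and gt: "e powr p < (\<Sum>n<M. norm (tail m f (\<phi> n)) powr p * w n)"
    using assms garling_norm_le_iff[of e "tail m f"] by (auto simp: not_le)
  define k where "k = (LEAST n. m \<le> \<phi> n)"
  have "m \<le> \<phi> m" using strict_mono_imp_increasing[OF \<phi>] .
  then have k: "m \<le> \<phi> k" unfolding k_def by (rule LeastI)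
  have below: "\<phi> n < m" if "n < k" for n
    using not_less_Least[of n "\<lambda>n. m \<le> \<phi> n"] that by (auto simp: k_def)
  have above: "m \<le> \<phi> (k + n)" for n
    using k strict_mono_mono[OF \<phi>] by (meson le_add1 monoD order_trans)
  let ?t = "\<lambda>n. norm (tail m f (\<phi> n)) powr p * w n"
  have "(\<Sum>n<M. ?t n) \<le> (\<Sum>n<k + M. ?t n)"
    by (intro sum_mono2) (auto simp: w_nonneg)
  also have "\<dots> = (\<Sum>n<k. ?t n) + (\<Sum>n<M. ?t (k + n))"
    by (rule sum_lessThan_add)
  also have "(\<Sum>n<k. ?t n) = 0"
    using below by (intro sum.neutral) (auto simp: tail_def)
  also have "0 + (\<Sum>n<M. ?t (k + n)) \<le> (\<Sum>n<M. norm (f (\<phi> (k + n))) powr p * w n)"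
    unfolding add_0_left
  proof (intro sum_mono mult_mono)
    show "norm (tail m f (\<phi> (k + n))) powr p \<le> norm (f (\<phi> (k + n))) powr p" for n
      using above[of n] by (simp add: tail_def)
    show "w (k + n) \<le> w n" for n by (rule w_antimono) simp
  qed (auto simp: w_nonneg)
  finally have "e powr p < (\<Sum>n<M. norm (f (\<phi> (k + n))) powr p * w n)"
    using gt by linarith
  moreover have "strict_mono (\<lambda>n. \<phi> (k + n))"
    using \<phi> by (simp add: strict_mono_def)
  ultimately show thesis using that above by blast
qed

text \<open>A gliding hump argument. If infinitely many tails had norm above \<open>e\<close>, then a selection of
  \<open>K\<close> entries can be continued by the entries that a far-off tail selects at positions from
  \<open>K\<close> on; these keep their weights. The \<open>K\<close> entries of the tail that get lost are negligible
  because \<open>f\<close> tends to zero. So each continuation gains a fixed amount.\<close>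

lemma eventually_tail_norm_le:
  fixes f :: "nat \<Rightarrow> 'a::real_normed_field"
  assumes f: "f \<in> garling_space w p" and "\<not> summable w" and e: "0 < e"
  shows "\<forall>\<^sub>F m in sequentially. garling_norm w p (tail m f) \<le> ennreal e"
proof (rule ccontr)
  assume "\<not> ?thesis"
  then have large: "\<exists>m\<ge>m0. \<not> garling_norm w p (tail m f) \<le> ennreal e" for m0
    by (auto simp: eventually_sequentially)
  define d where "d = e powr p"
  have d: "0 < d" using e by (simp add: d_def)
  let ?F = "\<lambda>k. norm (f k) powr p"
  have F_lim: "?F \<longlonglongrightarrow> 0"
  proof -
    have "(\<lambda>k. norm (f k)) \<longlonglongrightarrow> 0"
      using tendsto_norm_zero[OF tendsto_0_if_in_space[OF f assms(2)]] .
    then have "?F \<longlonglongrightarrow> 0 powr p"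
      using p_pos by (intro tendsto_powr2) auto
    then show ?thesis by simp
  qed
  obtain B where B: "\<And>\<phi> M. strict_mono \<phi> \<Longrightarrow> (\<Sum>n<M. ?F (\<phi> n) * w n) \<le> B"
    using garling_spaceE[OF f] by metis
  have "\<exists>\<phi> K. strict_mono \<phi> \<and> real j * (d / 2) \<le> (\<Sum>n<K. ?F (\<phi> n) * w n)" for j
  proof (induction j)
    case 0
    have "strict_mono (\<lambda>n::nat. n)" by (simp add: strict_mono_def)
    moreover have "real 0 * (d / 2) \<le> (\<Sum>n<0. ?F n * w n)" by simp
    ultimately show ?case by blast
  next
    case (Suc j)
    then obtain \<phi> K where \<phi>: "strict_mono \<phi>"
      and IH: "real j * (d / 2) \<le> (\<Sum>n<K. ?F (\<phi> n) * w n)" by blast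
    have "0 < d / (2 * real (Suc K))" using d by simp
    then have "\<forall>\<^sub>F k in sequentially. ?F k < d / (2 * real (Suc K))"
      using order_tendstoD(2)[OF F_lim] by blast
    then obtain k0 where k0: "\<And>k. k0 \<le> k \<Longrightarrow> ?F k < d / (2 * real (Suc K))"
      by (auto simp: eventually_sequentially)
    obtain m where m: "max k0 (Suc (\<phi> K)) \<le> m" "\<not> garling_norm w p (tail m f) \<le> ennreal e"
      using large by blast
    obtain \<psi> M where \<psi>: "strict_mono \<psi>" "\<And>n. m \<le> \<psi> n"
      and gt: "d < (\<Sum>n<M. ?F (\<psi> n) * w n)"
      using tail_norm_witness[OF less_imp_le[OF e] m(2)] unfolding d_def by metis
    define \<theta> where "\<theta> n = (if n < K then \<phi> n else \<psi> n)" for n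
    have "\<theta> a < \<theta> b" if "a < b" for a b
    proof -
      consider "b < K" | "a < K" "K \<le> b" | "K \<le> a" by linarith
      then show ?thesis
      proof cases
        case 2
        have "\<phi> a < \<phi> K" using \<phi> 2 by (simp add: strict_mono_less)
        also have "\<phi> K < m" using m(1) by simp
        also have "m \<le> \<psi> b" by (rule \<psi>(2))
        finally show ?thesis using 2 by (simp add: \<theta>_def)
      qed (use that \<phi> \<psi>(1) in \<open>auto simp: \<theta>_def strict_mono_less\<close>)
    qed
    then have \<theta>: "strict_mono \<theta>" by (simp add: strict_mono_def)
    have lost: "(\<Sum>n<K. ?F (\<psi> n) * w n) \<le> d / 2"
    proof -
      have "(\<Sum>n<K. ?F (\<psi> n) * w n) \<le> (\<Sum>n<K. d / (2 * real (Suc K)) * 1)"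
      proof (intro sum_mono mult_mono w_le_1)
        show "?F (\<psi> n) \<le> d / (2 * real (Suc K))" for n
          using k0[of "\<psi> n"] \<psi>(2)[of n] m(1) by simp
      qed (use d w_nonneg in auto)
      also have "\<dots> = d / 2 * (real K / real (Suc K))" by (simp add: field_simps)
      also have "\<dots> \<le> d / 2 * 1"
        using d by (intro mult_left_mono) auto
      finally show ?thesis by simp
    qed
    have "(\<Sum>n<M. ?F (\<psi> n) * w n) \<le> (\<Sum>n<K + M. ?F (\<psi> n) * w n)"
      by (intro sum_mono2) (auto simp: w_nonneg)
    also have "\<dots> = (\<Sum>n<K. ?F (\<psi> n) * w n) + (\<Sum>n<M. ?F (\<psi> (K + n)) * w (K + n))"
      by (rule sum_lessThan_add)
    finally have gain: "d / 2 \<le> (\<Sum>n<M. ?F (\<psi> (K + n)) * w (K + n))"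
      using gt lost by linarith
    have "(\<Sum>n<K + M. ?F (\<theta> n) * w n)
        = (\<Sum>n<K. ?F (\<theta> n) * w n) + (\<Sum>n<M. ?F (\<theta> (K + n)) * w (K + n))"
      by (rule sum_lessThan_add)
    also have "\<dots> = (\<Sum>n<K. ?F (\<phi> n) * w n) + (\<Sum>n<M. ?F (\<psi> (K + n)) * w (K + n))"
      by (simp add: \<theta>_def)
    finally have "real (Suc j) * (d / 2) \<le> (\<Sum>n<K + M. ?F (\<theta> n) * w n)"
      using IH gain by (simp add: algebra_simps)
    with \<theta> show ?case by blast
  qed
  then have "real j * (d / 2) \<le> B" for j
    using B order_trans by meson
  moreover obtain j where "B < real j * (d / 2)"
    using reals_Archimedean3[of "d / 2"] d by auto
  ultimately show False by (meson not_le)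
qed

lemma tail_norm_tendsto_0:
  fixes f :: "nat \<Rightarrow> 'a::real_normed_field"
  assumes "f \<in> garling_space w p" and "\<not> summable w"
  shows "(\<lambda>m. garling_norm w p (tail m f)) \<longlonglongrightarrow> 0"
proof (rule order_tendstoI)
  fix a :: ennreal
  assume "0 < a"
  then obtain b where b: "0 < b" "b < a" using dense by blast
  then obtain e where e: "b = ennreal e" "0 < e"
    by (cases b) auto
  show "\<forall>\<^sub>F m in sequentially. garling_norm w p (tail m f) < a"
    using eventually_tail_norm_le[OF assms e(2)]
    by eventually_elim (use b e in auto)
qed auto

lemma lin_comb_unit_vec:
  assumes "finite A"
  shows "lin_comb A a unit_vec k = (if k \<in> A then a k else 0)"
proof -
  have "lin_comb A a unit_vec k = (\<Sum>n\<in>A. if k = n then a n else 0)"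
    unfolding lin_comb_def unit_vec_def by (intro sum.cong) auto
  then show ?thesis using assms by simp
qed

lemma schauder_basis_unit_vec:
  assumes "\<not> summable w"
  shows "schauder_basis (garling_space w p) (garling_norm w p)
    (unit_vec :: nat \<Rightarrow> nat \<Rightarrow> 'a::real_normed_field)"
  unfolding schauder_basis_def
proof (intro conjI ballI)
  show "range unit_vec \<subseteq> (garling_space w p :: (nat \<Rightarrow> 'a) set)"
    using unit_vec_in_space by blast
next
  fix f :: "nat \<Rightarrow> 'a"
  assume f: "f \<in> garling_space w p"
  let ?r = "\<lambda>a m k. f k - lin_comb {..<m} a unit_vec k"
  show "\<exists>!a. (\<lambda>m. garling_norm w p (?r a m)) \<longlonglongrightarrow> 0"
  proof (rule ex1I)
    have "?r f m = tail m f" for m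
      by (auto simp: lin_comb_unit_vec tail_def)
    then show "(\<lambda>m. garling_norm w p (?r f m)) \<longlonglongrightarrow> 0"
      using tail_norm_tendsto_0[OF f assms] by simp
  next
    fix a :: "nat \<Rightarrow> 'a"
    assume lim: "(\<lambda>m. garling_norm w p (?r a m)) \<longlonglongrightarrow> 0"
    show "a = f"
    proof
      fix k
      have "ennreal (norm (f k - a k)) \<le> garling_norm w p (?r a m)" if "k < m" for m
        using norm_coordinate_le[of "?r a m" k] that by (simp add: lin_comb_unit_vec)
      then have "\<forall>\<^sub>F m in sequentially.
          ennreal (norm (f k - a k)) \<le> garling_norm w p (?r a m)"
        using eventually_gt_at_top[of k] by (rule eventually_mono[rotated])
      then have "ennreal (norm (f k - a k)) \<le> 0"
        using lim by (intro tendsto_lowerbound[OF lim]) auto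
      then show "a k = f k" by simp
    qed
  qed
qed

section \<open>Partial sums of a bi-regular weight\<close>

text \<open>With indices starting at zero, \<open>S m\<close> has \<open>m + 1\<close> terms.\<close>

definition S :: "nat \<Rightarrow> real" where
  "S m = (\<Sum>n\<le>m. w n)"

lemma S_mono: "m \<le> n \<Longrightarrow> S m \<le> S n"
  unfolding S_def by (intro sum_mono2) (auto simp: w_nonneg)

lemma S_ge_1: "1 \<le> S m"
  using S_mono[of 0 m] by (simp add: S_def w_0)

lemma S_pos: "0 < S m"
  using S_ge_1[of m] by linarith

lemma S_ge: "real (Suc m) * w m \<le> S m"
proof -
  have "(\<Sum>n\<le>m. w m) \<le> S m"
    unfolding S_def by (intro sum_mono w_antimono) auto
  then show ?thesis by simp
qed

lemma S_double:
  assumes "m \<le> 2 * i"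
  shows "S m \<le> 2 * S i"
proof -
  have "S m \<le> (\<Sum>n<Suc i + Suc i. w n)"
    unfolding S_def using assms by (intro sum_mono2) (auto simp: w_nonneg)
  also have "\<dots> = (\<Sum>n<Suc i. w n) + (\<Sum>n<Suc i. w (Suc i + n))"
    by (rule sum_lessThan_add)
  also have "\<dots> \<le> (\<Sum>n<Suc i. w n) + (\<Sum>n<Suc i. w n)"
    by (intro add_left_mono sum_mono w_antimono) auto
  finally show ?thesis by (simp add: S_def lessThan_Suc_atMost)
qed

lemma regular_weightE:
  assumes "regular_weight w"
  obtains R where "0 < R" and "\<And>m. S m \<le> R * (real (Suc m) * w m)"
proof -
  obtain R where R: "\<And>m. 1 / (real (Suc m) * w m) * S m \<le> R"
    using assms unfolding regular_weight_def S_def bdd_above_def by auto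
  have *: "S m \<le> R * (real (Suc m) * w m)" for m
    using R[of m] w_pos[of m] by (simp add: divide_le_eq)
  have "0 < R" using *[of 0] S_pos[of 0] w_0 by simp
  with * that show thesis by blast
qed

lemma regular_conj_weightE:
  assumes "regular_weight (conj_weight w)"
  obtains Q where "\<And>m. w m * (\<Sum>n\<le>m. 1 / (real (Suc n) * w n)) \<le> Q"
proof -
  obtain Q where Q: "\<And>m. 1 / (real (Suc m) * conj_weight w m) * (\<Sum>n\<le>m. conj_weight w n) \<le> Q"
    using assms unfolding regular_weight_def bdd_above_def by auto
  have eq: "1 / (real (Suc m) * conj_weight w m) = w m" for m
    using w_pos[of m] by (simp add: conj_weight_def)
  have "w m * (\<Sum>n\<le>m. 1 / (real (Suc n) * w n)) \<le> Q" for m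
    using Q[of m] unfolding eq by (simp only: conj_weight_def)
  then show thesis by (rule that)
qed

lemma harmonic_unbounded: "\<exists>m. B < (\<Sum>n\<le>m. 1 / real (Suc n))"
proof (rule ccontr)
  assume "\<not> ?thesis"
  then have "(\<Sum>n\<le>m. 1 / real (Suc n)) \<le> B" for m by (simp add: not_less)
  then have "summable (\<lambda>n. 1 / real (Suc n))"
    by (intro bounded_imp_summable[where B = B]) auto
  then have "summable (\<lambda>n. 1 / real n)"
    by (subst (asm) summable_Suc_iff)
  then show False
    using not_summable_harmonic[where 'a = real] by (simp add: inverse_eq_divide)
qed

lemma regular_not_summable:
  assumes "regular_weight w"
  shows "\<not> summable w"
proof
  assume sum: "summable w"
  obtain R where R: "0 < R" "\<And>m. S m \<le> R * (real (Suc m) * w m)"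
    using regular_weightE[OF assms] by blast
  have le: "1 / real (Suc n) \<le> R * w n" for n
  proof -
    have "1 \<le> R * (real (Suc n) * w n)" using R(2)[of n] S_ge_1[of n] by linarith
    then show ?thesis by (simp add: divide_le_eq mult_ac)
  qed
  obtain m where "R * suminf w < (\<Sum>n\<le>m. 1 / real (Suc n))"
    using harmonic_unbounded by blast
  also have "\<dots> \<le> R * (\<Sum>n\<le>m. w n)"
    unfolding sum_distrib_left by (intro sum_mono le)
  also have "\<dots> \<le> R * suminf w"
    using R(1) sum by (intro mult_left_mono sum_le_suminf) (auto simp: w_nonneg)
  finally show False by simp
qed

lemma conj_regular_tendsto_0:
  assumes "regular_weight (conj_weight w)"
  shows "w \<longlonglongrightarrow> 0"
proof -
  obtain Q where Q: "\<And>m. w m * (\<Sum>n\<le>m. 1 / (real (Suc n) * w n)) \<le> Q"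
    using regular_conj_weightE[OF assms] by blast
  have small: "w m * (\<Sum>n\<le>m. 1 / real (Suc n)) \<le> Q" for m
  proof -
    have "1 / real (Suc n) \<le> 1 / (real (Suc n) * w n)" for n
      using w_pos[of n] w_le_1[of n] by (intro divide_left_mono) (auto simp: mult_left_le)
    then have "w m * (\<Sum>n\<le>m. 1 / real (Suc n)) \<le> w m * (\<Sum>n\<le>m. 1 / (real (Suc n) * w n))"
      by (intro mult_left_mono sum_mono w_nonneg) auto
    with Q[of m] show ?thesis by linarith
  qed
  show ?thesis
  proof (rule order_tendstoI)
    fix e :: real
    assume "0 < e"
    obtain m where m: "Q / e < (\<Sum>n\<le>m. 1 / real (Suc n))" using harmonic_unbounded by blast
    have "w m < e"
    proof (rule ccontr)
      assume "\<not> w m < e"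
      then have "e * (\<Sum>n\<le>m. 1 / real (Suc n)) \<le> w m * (\<Sum>n\<le>m. 1 / real (Suc n))"
        by (intro mult_right_mono sum_nonneg) auto
      with small[of m] m \<open>0 < e\<close> show False by (simp add: field_simps)
    qed
    then show "\<forall>\<^sub>F n in sequentially. w n < e"
      using w_antimono[of m] unfolding eventually_sequentially
      by (meson le_less_trans)
  next
    fix e :: real
    assume "e < 0"
    then show "\<forall>\<^sub>F n in sequentially. e < w n"
      using w_pos less_trans by (intro always_eventually) blast
  qed
qed

text \<open>Convolution-type sums \<open>\<Sum> w\<^sub>n / S\<^sub>i\<close> over \<open>n + i = j - 1\<close> stay bounded. The terms with
  \<open>n \<le> i\<close> contribute at most \<open>2\<close>, as there \<open>S\<^sub>i\<close> is comparable to \<open>S\<close> at \<open>j - 1\<close>; the others are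
  controlled by the regularity of the conjugate weight.\<close>

lemma reversed_sum_bounded:
  assumes Q: "\<And>m. w m * (\<Sum>n\<le>m. 1 / (real (Suc n) * w n)) \<le> Q"
  shows "(\<Sum>n<j. w n / S (j - Suc n)) \<le> 2 + Q"
proof (cases j)
  case 0
  have "0 \<le> w 0 * (\<Sum>n\<le>0. 1 / (real (Suc n) * w n))" using w_0 by simp
  then show ?thesis using 0 Q[of 0] by simp
next
  case (Suc l)
  define h where "h = l div 2"
  let ?u = "\<lambda>i. if i \<le> h then w h * (1 / (real (Suc i) * w i)) else 0"
  have "w n / S (j - Suc n) \<le> 2 * w n / S l + ?u (j - Suc n)" if "n < j" for n
  proof -
    define i where "i = j - Suc n"
    have i: "n + i = l" using that Suc by (simp add: i_def)
    show ?thesis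
    proof (cases "n \<le> i")
      case True
      then have "S l \<le> 2 * S i" using i by (intro S_double) simp
      then have "1 / S i \<le> 2 / S l" using S_pos by (simp add: field_simps)
      then have "w n * (1 / S i) \<le> w n * (2 / S l)" by (intro mult_left_mono w_nonneg)
      then have "w n / S i \<le> 2 * w n / S l" by (simp add: mult.commute)
      moreover have "0 \<le> ?u i" using w_nonneg by simp
      ultimately show ?thesis unfolding i_def[symmetric] by linarith
    next
      case False
      then have ih: "i \<le> h" "h \<le> n" using i by (auto simp: h_def)
      have "w n / S i \<le> w h / (real (Suc i) * w i)"
        using ih w_pos S_ge S_pos by (intro frac_le w_antimono w_nonneg) auto
      moreover have "0 \<le> 2 * w n / S l" using w_nonneg[of n] S_pos[of l] by simp
      ultimately show ?thesis unfolding i_def[symmetric] using ih by simp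
    qed
  qed
  then have "(\<Sum>n<j. w n / S (j - Suc n)) \<le> (\<Sum>n<j. 2 * w n / S l + ?u (j - Suc n))"
    by (intro sum_mono) simp
  also have "\<dots> = 2 * (\<Sum>n<j. w n) / S l + (\<Sum>n<j. ?u (j - Suc n))"
    by (simp only: sum.distrib sum_divide_distrib sum_distrib_left)
  also have "2 * (\<Sum>n<j. w n) / S l = 2"
    using S_pos[of l] Suc by (simp add: S_def lessThan_Suc_atMost)
  also have "(\<Sum>n<j. ?u (j - Suc n)) = (\<Sum>n<j. ?u n)"
    by (rule sum.nat_diff_reindex)
  also have "\<dots> = (\<Sum>n\<le>h. w h * (1 / (real (Suc n) * w n)))"
    by (rule sum.mono_neutral_cong_right) (auto simp: Suc h_def)
  also have "\<dots> \<le> Q"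
    using Q[of h] by (simp add: sum_distrib_left)
  finally show ?thesis by simp
qed

section \<open>Reversing blocks is not bounded\<close>

text \<open>A bound for the norm of a vector supported below \<open>E\<close> whose entry at distance \<open>i\<close> from \<open>E - 1\<close> is
  at most \<open>S\<^sub>i\<close> to the power \<open>-1/p\<close>. If a selection picks exactly \<open>j\<close> positions before \<open>E\<close>, its \<open>n\<close>-th pick is
  followed by \<open>j - 1 - n\<close> others, so that it lies at distance at least \<open>j - 1 - n\<close> from \<open>E - 1\<close>.\<close>

lemma increasing_block_norm_le:
  fixes a :: "nat \<Rightarrow> 'a::real_normed_field"
  assumes Q: "\<And>m. w m * (\<Sum>n\<le>m. 1 / (real (Suc n) * w n)) \<le> Q"
    and block: "\<And>k. k < E \<Longrightarrow> norm (a k) powr p \<le> 1 / S (E - Suc k)"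
    and zero: "\<And>k. E \<le> k \<Longrightarrow> a k = 0"
  shows "garling_norm w p a \<le> ennreal ((2 + Q) powr (1 / p))"
proof -
  have D: "0 \<le> 2 + Q" using reversed_sum_bounded[OF Q, of 0] by simp
  have "(\<Sum>n<M. norm (a (\<phi> n)) powr p * w n) \<le> 2 + Q" if \<phi>: "strict_mono \<phi>" for \<phi> M
  proof -
    define j where "j = (LEAST n. E \<le> \<phi> n)"
    have "E \<le> \<phi> E" using strict_mono_imp_increasing[OF \<phi>] .
    then have j: "E \<le> \<phi> j" unfolding j_def by (rule LeastI)
    have below: "\<phi> n < E" if "n < j" for n
      using not_less_Least[of n "\<lambda>n. E \<le> \<phi> n"] that by (auto simp: j_def)
    have above: "E \<le> \<phi> n" if "j \<le> n" for n
      using j strict_mono_mono[OF \<phi>] that by (meson monoD order_trans)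
    let ?g = "\<lambda>n. if n < j then w n / S (j - Suc n) else 0"
    have gap: "\<phi> n + d \<le> \<phi> (n + d)" for n d
    proof (induction d)
      case (Suc d)
      have "\<phi> (n + d) < \<phi> (n + Suc d)" using \<phi> by (simp add: strict_mono_less)
      with Suc show ?case by simp
    qed simp
    have "norm (a (\<phi> n)) powr p * w n \<le> ?g n" for n
    proof (cases "n < j")
      case True
      have "\<phi> n + (j - Suc n) \<le> \<phi> (n + (j - Suc n))" by (rule gap)
      also have "\<dots> < E" using True by (intro below) simp
      finally have "j - Suc n \<le> E - Suc (\<phi> n)" by simp
      then have "1 / S (E - Suc (\<phi> n)) \<le> 1 / S (j - Suc n)"
        using S_mono S_pos by (intro divide_left_mono) auto
      then have "norm (a (\<phi> n)) powr p \<le> 1 / S (j - Suc n)"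
        using block[OF below[OF True]] by linarith
      from mult_right_mono[OF this w_nonneg[of n]] show ?thesis using True by simp
    next
      case False
      then show ?thesis using zero above by simp
    qed
    then have "(\<Sum>n<M. norm (a (\<phi> n)) powr p * w n) \<le> (\<Sum>n<M. ?g n)"
      by (intro sum_mono)
    also have "\<dots> \<le> (\<Sum>n<M + j. ?g n)"
      using w_nonneg S_pos by (intro sum_mono2) (auto intro!: divide_nonneg_pos)
    also have "\<dots> = (\<Sum>n<j. w n / S (j - Suc n))"
      by (rule sum.mono_neutral_cong_right) auto
    also have "\<dots> \<le> 2 + Q" by (rule reversed_sum_bounded[OF Q])
    finally show ?thesis .
  qed
  moreover have "((2 + Q) powr (1 / p)) powr p = 2 + Q"
    using D p_pos by (simp add: powr_powr)
  ultimately show ?thesis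
    using garling_norm_le_iff[of "(2 + Q) powr (1 / p)" a] by auto
qed

text \<open>The permutation of \<open>\<nat>\<close> that reverses each of the consecutive blocks of lengths
  \<open>1, 2, 3, \<dots>\<close>. These blocks are the diagonals of the Cantor enumeration of pairs, on which the
  reversal is the exchange of the components.\<close>

definition block_rev :: "nat \<Rightarrow> nat" where
  "block_rev n = prod_encode (prod.swap (prod_decode n))"

lemma block_rev_block_rev: "block_rev (block_rev n) = n"
  by (simp add: block_rev_def)

lemma bij_block_rev: "bij block_rev"
  by (rule involuntory_imp_bij) (rule block_rev_block_rev)

lemma block_rev_triangle: "i \<le> L \<Longrightarrow> block_rev (triangle L + i) = triangle L + (L - i)"
proof -
  assume "i \<le> L"
  then have eq: "triangle L + i = prod_encode (i, L - i)"
    by (simp add: prod_encode_def)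
  have "block_rev (triangle L + i) = prod_encode (L - i, i)"
    unfolding block_rev_def eq by simp
  with \<open>i \<le> L\<close> show ?thesis
    by (simp add: prod_encode_def)
qed

text \<open>On a block of length \<open>L + 1\<close>, take the entries \<open>S\<^sub>i\<close> to the power \<open>-1/p\<close>. In increasing order
  they form a vector whose norm is bounded independently of \<open>L\<close>; in decreasing order the selection
  of the whole block gives \<open>\<Sum> w\<^sub>n / S\<^sub>n\<close>, which is at least a multiple of a harmonic sum.\<close>

lemma not_equivalent_block_rev:
  assumes "bi_regular w"
  shows "\<not> equivalent_seqs (garling_norm w p)
    (unit_vec :: nat \<Rightarrow> nat \<Rightarrow> 'a::real_normed_field) (unit_vec \<circ> block_rev)"
proof
  assume "equivalent_seqs (garling_norm w p) (unit_vec :: nat \<Rightarrow> nat \<Rightarrow> 'a) (unit_vec \<circ> block_rev)"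
  then obtain C where C: "C > 0" and eq: "\<And>a :: nat \<Rightarrow> 'a. finite {n. a n \<noteq> 0} \<Longrightarrow>
      ennreal (1 / C) * garling_norm w p (lin_comb {n. a n \<noteq> 0} a (unit_vec \<circ> block_rev))
        \<le> garling_norm w p (lin_comb {n. a n \<noteq> 0} a unit_vec)"
    unfolding equivalent_seqs_def by blast
  obtain R where R: "0 < R" "\<And>m. S m \<le> R * (real (Suc m) * w m)"
    using assms regular_weightE unfolding bi_regular_def by blast
  obtain Q where Q: "\<And>m. w m * (\<Sum>n\<le>m. 1 / (real (Suc n) * w n)) \<le> Q"
    using assms regular_conj_weightE unfolding bi_regular_def by blast
  define D where "D = (2 + Q) powr (1 / p)"
  have bound: "(\<Sum>n\<le>L. 1 / real (Suc n)) \<le> R * (C * D) powr p" for L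
  proof -
    define E where "E = Suc (triangle L + L)"
    define a :: "nat \<Rightarrow> 'a" where
      "a k = (if triangle L \<le> k \<and> k < E then of_real ((1 / S (E - Suc k)) powr (1 / p)) else 0)" for k
    have norm_a: "norm (a k) powr p = 1 / S (E - Suc k)" if "triangle L \<le> k" "k < E" for k
      using that S_pos[of "E - Suc k"] p_pos by (simp add: a_def powr_powr)
    have fin: "finite {n. a n \<noteq> 0}"
      by (rule finite_subset[of _ "{..<E}"]) (auto simp: a_def)
    have a_x: "lin_comb {n. a n \<noteq> 0} a unit_vec = a"
      by (rule ext) (simp add: lin_comb_unit_vec[OF fin])
    have a_y: "lin_comb {n. a n \<noteq> 0} a (unit_vec \<circ> block_rev) = (\<lambda>k. a (block_rev k))"
    proof
      fix k
      have "lin_comb {n. a n \<noteq> 0} a (unit_vec \<circ> block_rev) k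
          = lin_comb {n. a n \<noteq> 0} a unit_vec (block_rev k)"
        unfolding lin_comb_def
        by (intro sum.cong) (auto simp: unit_vec_def block_rev_block_rev)
      then show "lin_comb {n. a n \<noteq> 0} a (unit_vec \<circ> block_rev) k = a (block_rev k)"
        by (simp add: a_x)
    qed
    have "garling_norm w p a \<le> ennreal D"
      unfolding D_def
    proof (rule increasing_block_norm_le[OF Q, where E = E])
      show "norm (a k) powr p \<le> 1 / S (E - Suc k)" if "k < E" for k
        using norm_a[of k] that S_pos[of "E - Suc k"] by (cases "triangle L \<le> k") (auto simp: a_def)
    qed (simp add: a_def)
    then have "ennreal (1 / C) * garling_norm w p (\<lambda>k. a (block_rev k)) \<le> ennreal D"
      using eq[OF fin] unfolding a_x a_y by (rule order_trans[rotated])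
    then have "ennreal C * (ennreal (1 / C) * garling_norm w p (\<lambda>k. a (block_rev k)))
        \<le> ennreal C * ennreal D"
      by (rule mult_left_mono) simp
    moreover have "ennreal C * ennreal (1 / C) = 1"
      using C by (simp add: ennreal_mult[symmetric])
    moreover have "0 \<le> D" by (simp add: D_def)
    ultimately have norm_y: "garling_norm w p (\<lambda>k. a (block_rev k)) \<le> ennreal (C * D)"
      using C by (simp add: mult.assoc[symmetric] ennreal_mult)
    have CD: "0 \<le> C * D" using C by (simp add: D_def)
    have "strict_mono (\<lambda>n. triangle L + n)" by (simp add: strict_mono_def)
    from garling_norm_leD[OF norm_y CD this]
    have "(\<Sum>n<Suc L. norm (a (block_rev (triangle L + n))) powr p * w n) \<le> (C * D) powr p" .
    moreover have "norm (a (block_rev (triangle L + n))) powr p = 1 / S n" if "n < Suc L" for n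
      using that norm_a[of "triangle L + (L - n)"] by (simp add: block_rev_triangle E_def)
    ultimately have *: "(\<Sum>n\<le>L. w n / S n) \<le> (C * D) powr p"
      by (simp add: lessThan_Suc_atMost[symmetric] del: sum.lessThan_Suc)
    have "1 / real (Suc n) \<le> R * (w n / S n)" for n
      using R(2)[of n] S_pos[of n] by (simp add: field_simps)
    then have "(\<Sum>n\<le>L. 1 / real (Suc n)) \<le> R * (\<Sum>n\<le>L. w n / S n)"
      unfolding sum_distrib_left by (intro sum_mono)
    also have "\<dots> \<le> R * (C * D) powr p"
      using * R(1) by (intro mult_left_mono) auto
    finally show ?thesis .
  qed
  obtain L where "R * (C * D) powr p < (\<Sum>n\<le>L. 1 / real (Suc n))"
    using harmonic_unbounded by blast
  with bound[of L] show False by simp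
qed

lemma not_symmetric_basis_unit_vec:
  assumes "bi_regular w"
  shows "\<not> symmetric_basis X (garling_norm w p) (unit_vec :: nat \<Rightarrow> nat \<Rightarrow> 'a::real_normed_field)"
  using not_equivalent_block_rev[OF assms] bij_block_rev unfolding symmetric_basis_def by metis

end

section \<open>Garling spaces of bi-regular weights\<close>

theorem theorem5p10:
  fixes w :: "nat \<Rightarrow> real" and p :: real
  assumes "weight w" and "normalized w" and "decseq w" and "bi_regular w" and "1 \<le> p"
  shows "w \<in> weight_class \<and>
    (schauder_basis (garling_space w p) (garling_norm w p) (unit_vec :: nat \<Rightarrow> nat \<Rightarrow> real) \<and>
     \<not> symmetric_basis (garling_space w p) (garling_norm w p) (unit_vec :: nat \<Rightarrow> nat \<Rightarrow> real)) \<and>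
    (schauder_basis (garling_space w p) (garling_norm w p) (unit_vec :: nat \<Rightarrow> nat \<Rightarrow> complex) \<and>
     \<not> symmetric_basis (garling_space w p) (garling_norm w p) (unit_vec :: nat \<Rightarrow> nat \<Rightarrow> complex))"
proof -
  interpret garling_weight w p
    using assms by unfold_locales (auto simp: weight_def normalized_def)
  have reg: "regular_weight w" "regular_weight (conj_weight w)"
    using assms(4) by (auto simp: bi_regular_def)
  have ns: "\<not> summable w" by (rule regular_not_summable[OF reg(1)])
  have "w \<in> weight_class"
    using conj_regular_tendsto_0[OF reg(2)] ns w_0 w_dec w_pos by (simp add: weight_class_def)
  then show ?thesis
    by (intro conjI schauder_basis_unit_vec not_symmetric_basis_unit_vec ns assms(4))
qed

end
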